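(* There is an absolute constant $C$ such that every graph $H$ with $s\ge R\ge8$ edges and minimum degree at least $2$ that is bicycle-free at radius $R$ satisfies $$\operatorname{rank}(H)\le1+\frac{C\,s\log s}{R}.$$
   Context: Graphs are finite and simple. Here $s$ is the number of edges of $H$, and $\operatorname{rank}(H)$ is the cycle rank of $H$, that is, the dimension of its cycle space over $\mathbb F_2$ (equal to $|E(H)|-|V(H)|$ plus the number of connected components). $H$ is bicycle-free at radius $R$ if for every vertex $v$ of $H$ the ball of radius $R$ around $v$ in $H$ contains at most one cycle.
   Formalization: The graph H is additionally assumed connected; without this the claim is false, e.g. for m disjoint triangles with R = s = 3m, where the rank is m but the bound is 1 + C log(3m). *)

theory Defs
  imports Complex_Main "HOL-Library.Z2" "HOL-Library.Function_Algebras"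
begin

definition simple_graph :: "'a set \<Rightarrow> 'a set set \<Rightarrow> bool" where
  "simple_graph V E \<longleftrightarrow> finite V \<and> (\<forall>e\<in>E. e \<subseteq> V \<and> card e = 2)"

definition adj :: "'a set set \<Rightarrow> ('a \<times> 'a) set" where
  "adj E = {(u, v). {u, v} \<in> E}"

definition connected_graph :: "'a set \<Rightarrow> 'a set set \<Rightarrow> bool" where
  "connected_graph V E \<longleftrightarrow> V \<noteq> {} \<and> (\<forall>u\<in>V. \<forall>v\<in>V. (u, v) \<in> (adj E)\<^sup>*)"

definition degree :: "'a set set \<Rightarrow> 'a \<Rightarrow> nat" where
  "degree E v = card {e \<in> E. v \<in> e}"

text \<open>Cycles are identified with their edge sets, so that neither the starting vertex nor the
  orientation of a cyclic vertex sequence matters when cycles are counted.\<close>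

definition cycle_edges :: "'a list \<Rightarrow> 'a set set" where
  "cycle_edges p = {{p ! i, p ! ((i + 1) mod length p)} | i. i < length p}"

definition cycles :: "'a set set \<Rightarrow> 'a set set set" where
  "cycles E = {cycle_edges p | p. distinct p \<and> 3 \<le> length p \<and> cycle_edges p \<subseteq> E}"

text \<open>A pair is in the \<open>n\<close>-th relational power of \<open>adj E\<close> iff it is joined by a walk with \<open>n\<close>
  edges; hence the following is the set of vertices at distance at most \<open>r\<close> from \<open>v\<close>.\<close>

definition ball_verts :: "'a set \<Rightarrow> 'a set set \<Rightarrow> 'a \<Rightarrow> real \<Rightarrow> 'a set" where
  "ball_verts V E v r = {u \<in> V. \<exists>n. real n \<le> r \<and> (v, u) \<in> adj E ^^ n}"

definition induced_edges :: "'a set set \<Rightarrow> 'a set \<Rightarrow> 'a set set" where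
  "induced_edges E S = {e \<in> E. e \<subseteq> S}"

definition bicycle_free :: "'a set \<Rightarrow> 'a set set \<Rightarrow> real \<Rightarrow> bool" where
  "bicycle_free V E r \<longleftrightarrow>
     (\<forall>v\<in>V. \<forall>A \<in> cycles (induced_edges E (ball_verts V E v r)).
             \<forall>B \<in> cycles (induced_edges E (ball_verts V E v r)). A = B)"

text \<open>The type \<open>bit\<close> is the field with two elements; an edge set is represented by its indicator
  function. The cycle space is the kernel of the incidence map over this field, i.e. the space of
  edge sets meeting every vertex an even number of times.\<close>

definition F2_scale :: "bit \<Rightarrow> ('e \<Rightarrow> bit) \<Rightarrow> ('e \<Rightarrow> bit)" where
  "F2_scale c f = (\<lambda>e. c * f e)"

lemma vector_space_F2_scale: "vector_space F2_scale"
  by standard (auto simp: F2_scale_def fun_eq_iff plus_fun_def algebra_simps)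

definition cycle_space :: "'a set \<Rightarrow> 'a set set \<Rightarrow> ('a set \<Rightarrow> bit) set" where
  "cycle_space V E =
     {f. (\<forall>e. e \<notin> E \<longrightarrow> f e = 0) \<and> (\<forall>v\<in>V. (\<Sum>e\<in>{e \<in> E. v \<in> e}. f e) = 0)}"

definition cycle_rank :: "'a set \<Rightarrow> 'a set set \<Rightarrow> nat" where
  "cycle_rank V E = vector_space.dim F2_scale (cycle_space V E)"

end

theory Submission
  imports Defs
begin

text \<open>A low-diameter decomposition. Grow a ball inside the set \<open>W\<close> of remaining vertices. As long as
  the boundary of the ball has more than an \<open>\<epsilon>\<close>-fraction of its inner edges, the number of inner
  edges grows by the factor \<open>1 + \<epsilon>\<close>; hence for \<open>\<epsilon>\<close> of order \<open>log s / R\<close> the growth stops before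
  radius \<open>R\<close>. Cut off that ball and continue. Each ball is connected with at most one cycle, so it
  has at most as many edges as vertices, and at most \<open>\<epsilon> s\<close> edges are cut in total. This gives
  \<open>|E| \<le> |V| + \<epsilon> s\<close>, while the cycle rank of a connected graph is at most \<open>|E| - |V| + 1\<close>.\<close>

section \<open>Induced edge sets and finiteness\<close>

lemma induced_edges_mono: "S \<subseteq> S' \<Longrightarrow> induced_edges E S \<subseteq> induced_edges E S'"
  by (auto simp: induced_edges_def)

lemma induced_edges_subset: "induced_edges E S \<subseteq> E"
  by (auto simp: induced_edges_def)

lemma simple_graph_finite_edges:
  assumes "simple_graph V E"
  shows "finite E"
proof -
  have "E \<subseteq> Pow V" "finite V" using assms by (auto simp: simple_graph_def)
  then show ?thesis by (meson finite_Pow_iff finite_subset)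
qed

section \<open>Trees, fundamental cycles and spanning trees\<close>

text \<open>Building trees by attaching leaves gives one induction principle from which the edge
  count, the paths and the acyclicity used below all follow.\<close>

inductive tree :: "'a set \<Rightarrow> 'a set set \<Rightarrow> bool" where
  single: "tree {v} {}"
| leaf: "tree S T \<Longrightarrow> u \<in> S \<Longrightarrow> w \<notin> S \<Longrightarrow> tree (insert w S) (insert {u, w} T)"

lemma tree_finite_verts: "tree S T \<Longrightarrow> finite S"
  by (induction rule: tree.induct) auto

lemma tree_edges_subset: "tree S T \<Longrightarrow> T \<subseteq> Pow S"
  by (induction rule: tree.induct) auto

lemma tree_finite_edges: "tree S T \<Longrightarrow> finite T"
  by (induction rule: tree.induct) auto

lemma tree_card: "tree S T \<Longrightarrow> card S = Suc (card T)"
proof (induction rule: tree.induct)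
  case (leaf S T u w)
  have "{u, w} \<notin> T" using tree_edges_subset[OF leaf.hyps(1)] leaf.hyps(3) by auto
  then show ?case
    using leaf tree_finite_verts[OF leaf.hyps(1)] tree_finite_edges[OF leaf.hyps(1)] by simp
qed simp

lemma tree_path:
  "tree S T \<Longrightarrow> a \<in> S \<Longrightarrow> b \<in> S \<Longrightarrow>
    \<exists>p. p \<noteq> [] \<and> hd p = a \<and> last p = b \<and> distinct p \<and> set p \<subseteq> S
      \<and> successively (\<lambda>x y. {x, y} \<in> T) p"
proof (induction arbitrary: a b rule: tree.induct)
  case (single v)
  then show ?case by (intro exI[of _ "[v]"]) auto
next
  case (leaf S T u w)
  have mono: "successively (\<lambda>x y. {x, y} \<in> insert {u, w} T) p"
    if "successively (\<lambda>x y. {x, y} \<in> T) p" for p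
    using that by (rule successively_mono) auto
  have to_leaf: "\<exists>p. p \<noteq> [] \<and> hd p = a \<and> last p = w \<and> distinct p \<and> set p \<subseteq> insert w S
      \<and> successively (\<lambda>x y. {x, y} \<in> insert {u, w} T) p" if a: "a \<in> S" for a
  proof -
    obtain p where p: "p \<noteq> []" "hd p = a" "last p = u" "distinct p" "set p \<subseteq> S"
      "successively (\<lambda>x y. {x, y} \<in> T) p"
      using leaf.IH[OF a leaf.hyps(2)] by blast
    show ?thesis
      using p leaf.hyps(3) mono[OF p(6)]
      by (intro exI[of _ "p @ [w]"]) (auto simp: successively_append_iff)
  qed
  consider "a \<in> S" "b \<in> S" | "a \<in> S" "b = w" | "a = w" "b \<in> S" | "a = w" "b = w"
    using leaf.prems by auto
  then show ?case
  proof cases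
    case 1
    then obtain p where "p \<noteq> []" "hd p = a" "last p = b" "distinct p" "set p \<subseteq> S"
      "successively (\<lambda>x y. {x, y} \<in> T) p"
      using leaf.IH by blast
    then show ?thesis using mono[of p] by (intro exI[of _ p]) auto
  next
    case 2
    then show ?thesis using to_leaf by blast
  next
    case 3
    then obtain p where p: "p \<noteq> []" "hd p = b" "last p = w" "distinct p" "set p \<subseteq> insert w S"
      "successively (\<lambda>x y. {x, y} \<in> insert {u, w} T) p"
      using to_leaf by blast
    have "successively (\<lambda>x y. {x, y} \<in> insert {u, w} T) (rev p)"
      using p(6) by (simp add: insert_commute)
    then show ?thesis
      using p 3 by (intro exI[of _ "rev p"]) (auto simp: hd_rev last_rev)
  next
    case 4
    then show ?thesis by (intro exI[of _ "[w]"]) auto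
  qed
qed

text \<open>The tree path from \<open>a\<close> to \<open>b\<close> is closed up by the new edge.
  That the cycle uses this edge is recorded because it later tells cycles of different non-tree
  edges apart.\<close>

lemma tree_insert_edge_cycle:
  assumes T: "tree S T" and ab: "a \<in> S" "b \<in> S" "a \<noteq> b" and new: "{a, b} \<notin> T"
  shows "\<exists>A \<in> cycles (insert {a, b} T). {a, b} \<in> A"
proof -
  obtain p where p: "p \<noteq> []" "hd p = a" "last p = b" "distinct p"
    "successively (\<lambda>x y. {x, y} \<in> T) p"
    using tree_path[OF T ab(1,2)] by blast
  \<comment> \<open>A path with one vertex would force \<open>a = b\<close>, and one with two
    vertices would put \<open>{a, b}\<close> into \<open>T\<close>.\<close>
  have len: "3 \<le> length p"
  proof (rule ccontr)
    assume "\<not> 3 \<le> length p"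
    moreover have "length p \<noteq> 0" using p(1) by simp
    ultimately have "length p = 1 \<or> length p = 2" by linarith
    then show False
      using p ab(3) new by (auto simp: length_Suc_conv numeral_2_eq_2)
  qed
  have step: "{p ! i, p ! Suc i} \<in> T" if "Suc i < length p" for i
    using p(5) that by (simp add: successively_conv_nth)
  have closing: "{p ! (length p - 1), p ! 0} = {a, b}"
    using p(1-3) by (auto simp: hd_conv_nth last_conv_nth)
  have "{p ! i, p ! ((i + 1) mod length p)} \<in> insert {a, b} T" if "i < length p" for i
  proof (cases "Suc i < length p")
    case True
    then show ?thesis using step[of i] by simp
  next
    case False
    then have i: "i = length p - 1" "Suc i = length p" using that by auto
    then show ?thesis using closing by simp
  qed
  then have "cycle_edges p \<subseteq> insert {a, b} T" by (auto simp: cycle_edges_def)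
  moreover have "{a, b} \<in> cycle_edges p"
    unfolding cycle_edges_def using closing p(1)
    by (intro CollectI exI[of _ "length p - 1"]) auto
  ultimately show ?thesis using p(4) len by (auto simp: cycles_def)
qed

text \<open>Peel off the last leaf: its vertex condition involves only one edge.\<close>
lemma tree_acyclic:
  "tree S T \<Longrightarrow> \<forall>e. e \<notin> T \<longrightarrow> f e = (0::bit) \<Longrightarrow> \<forall>v\<in>S. (\<Sum>e\<in>{e \<in> T. v \<in> e}. f e) = 0 \<Longrightarrow> f e = 0"
proof (induction arbitrary: e rule: tree.induct)
  case (leaf S T u w)
  have T: "T \<subseteq> Pow S" "finite T" using leaf.hyps(1) tree_edges_subset tree_finite_edges by auto
  have "{e \<in> insert {u, w} T. w \<in> e} = {{u, w}}" using T leaf.hyps(3) by auto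
  then have 0: "f {u, w} = 0" using leaf.prems(2) by auto
  have "(\<Sum>e\<in>{e \<in> T. v \<in> e}. f e) = 0" if "v \<in> S" for v
  proof -
    have "(\<Sum>e\<in>{e \<in> T. v \<in> e}. f e) = (\<Sum>e\<in>{e \<in> insert {u, w} T. v \<in> e}. f e)"
      using T 0 by (intro sum.mono_neutral_left) auto
    then show ?thesis using leaf.prems(2) that by simp
  qed
  moreover have "\<forall>e. e \<notin> T \<longrightarrow> f e = 0" using leaf.prems(1) 0 by (metis insert_iff)
  ultimately show ?case using leaf.IH by blast
qed simp

lemma spanning_tree_exists:
  assumes fin: "finite V" and v: "v \<in> V" and E: "E \<subseteq> Pow V"
    and reach: "\<And>u. u \<in> V \<Longrightarrow> (v, u) \<in> (adj E)\<^sup>*"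
  shows "\<exists>T \<subseteq> E. tree V T"
proof -
  have grow: "\<exists>S T. v \<in> S \<and> S \<subseteq> V \<and> T \<subseteq> E \<and> tree S T \<and> card S = Suc n" if "Suc n \<le> card V" for n
    using that
  proof (induction n)
    case 0
    show ?case using v tree.single[of v] by (intro exI[of _ "{v}"] exI[of _ "{}"]) auto
  next
    case (Suc n)
    then obtain S T where S: "v \<in> S" "S \<subseteq> V" "T \<subseteq> E" "tree S T" "card S = Suc n" by auto
    then obtain z where z: "z \<in> V" "z \<notin> S"
      using Suc.prems by (metis Suc_n_not_le_n subset_antisym subsetI)
    \<comment> \<open>If no edge left \<open>S\<close>, everything reachable from \<open>v\<close>
      would stay in \<open>S\<close>, contradicting the reachability of \<open>z\<close>.\<close>
    have "\<exists>u w. u \<in> S \<and> w \<notin> S \<and> {u, w} \<in> E"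
    proof (rule ccontr)
      assume no: "\<not> ?thesis"
      have "x \<in> S" if "(v, x) \<in> (adj E)\<^sup>*" for x
        using that by (induction rule: rtrancl_induct) (use S(1) no in \<open>auto simp: adj_def\<close>)
      then show False using reach z by blast
    qed
    then obtain u w where uw: "u \<in> S" "w \<notin> S" "{u, w} \<in> E" by blast
    then have "w \<in> V" using E by auto
    then show ?case
      using S uw tree.leaf[OF S(4) uw(1,2)] tree_finite_verts[OF S(4)]
      by (intro exI[of _ "insert w S"] exI[of _ "insert {u, w} T"]) auto
  qed
  obtain n where n: "card V = Suc n" using fin v by (metis card_eq_0_iff empty_iff not0_implies_Suc)
  then obtain S T where "S \<subseteq> V" "T \<subseteq> E" "tree S T" "card S = card V"
    using grow[of n] by auto
  then show ?thesis using fin card_subset_eq by blast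
qed

section \<open>Cycle rank of a connected graph\<close>

lemma sum_fun_apply: "(\<Sum>x\<in>A. g x) e = (\<Sum>x\<in>A. g x e)"
  for g :: "'a \<Rightarrow> 'b \<Rightarrow> 'c::comm_monoid_add"
  by (induction A rule: infinite_finite_induct) simp_all

text \<open>An element of the cycle space is determined by its values off a spanning tree
  \<open>T\<close>: if it vanishes there, it is supported on \<open>T\<close> and hence zero. So the
  rank is at most \<open>card (E - T)\<close>, and \<open>T\<close> has \<open>card V - 1\<close>
  edges.\<close>

lemma cycle_rank_le:
  assumes G: "simple_graph V E" and conn: "connected_graph V E"
  shows "cycle_rank V E + card V \<le> card E + 1"
proof -
  interpret vs: vector_space "F2_scale :: bit \<Rightarrow> ('a set \<Rightarrow> bit) \<Rightarrow> _"
    by (rule vector_space_F2_scale)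
  have finE: "finite E" using G by (rule simple_graph_finite_edges)
  have E: "E \<subseteq> Pow V" using G by (auto simp: simple_graph_def)
  obtain v where "v \<in> V" using conn by (auto simp: connected_graph_def)
  then obtain T where T: "T \<subseteq> E" "tree V T"
    using spanning_tree_exists[of V v E] G E conn
    by (auto simp: simple_graph_def connected_graph_def)
  define \<pi> :: "('a set \<Rightarrow> bit) \<Rightarrow> ('a set \<Rightarrow> bit)"
    where "\<pi> = (\<lambda>f e. if e \<in> E - T then f e else 0)"
  have lin: "Vector_Spaces.linear F2_scale F2_scale \<pi>"
    by unfold_locales (auto simp: \<pi>_def F2_scale_def fun_eq_iff plus_fun_def algebra_simps)
  let ?Z = "cycle_space V E"
  have sub: "vs.subspace ?Z"
  proof (rule vs.subspaceI)
    show "f + g \<in> ?Z" if "f \<in> ?Z" "g \<in> ?Z" for f g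
    proof -
      have "(\<Sum>e\<in>A. (f + g) e) = (\<Sum>e\<in>A. f e) + (\<Sum>e\<in>A. g e)" for A
        unfolding plus_fun_def by (rule sum.distrib)
      then show ?thesis using that by (simp add: cycle_space_def)
    qed
    show "F2_scale c f \<in> ?Z" if "f \<in> ?Z" for c f
    proof -
      have "(\<Sum>e\<in>A. F2_scale c f e) = c * (\<Sum>e\<in>A. f e)" for A
        unfolding F2_scale_def by (rule sum_distrib_left[symmetric])
      then show ?thesis using that by (simp add: cycle_space_def F2_scale_def)
    qed
  qed (simp add: cycle_space_def)
  have ker: "f = 0" if f: "f \<in> ?Z" and "\<pi> f = 0" for f
  proof
    fix e
    have *: "\<forall>e. e \<notin> T \<longrightarrow> f e = 0"
    proof (intro allI impI)
      fix e assume "e \<notin> T"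
      moreover have "\<pi> f e = 0" using that by simp
      ultimately show "f e = 0"
        using f by (cases "e \<in> E") (auto simp: \<pi>_def cycle_space_def)
    qed
    \<comment> \<open>Dropping the edges on which \<open>f\<close> vanishes leaves the vertex sums
      unchanged, so \<open>f\<close> meets the hypotheses of \<open>tree_acyclic\<close>.\<close>
    have "(\<Sum>e\<in>{e \<in> T. x \<in> e}. f e) = 0" if "x \<in> V" for x
    proof -
      have "(\<Sum>e\<in>{e \<in> T. x \<in> e}. f e) = (\<Sum>e\<in>{e \<in> E. x \<in> e}. f e)"
        using T(1) finE * by (intro sum.mono_neutral_left) auto
      then show ?thesis using f that by (simp add: cycle_space_def)
    qed
    then show "f e = 0 e" using tree_acyclic[OF T(2) *] by simp
  qed
  interpret lin: Vector_Spaces.linear F2_scale F2_scale \<pi> by (rule lin)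
  have inj: "inj_on \<pi> ?Z" using ker lin.inj_on_iff_eq_0[OF sub] by blast
  \<comment> \<open>The indicators of single non-tree edges span the image of \<open>\<pi>\<close>;
    the image of a basis of the cycle space stays independent, so it is no larger than this spanning
    set.\<close>
  define \<delta> :: "'a set \<Rightarrow> ('a set \<Rightarrow> bit)" where "\<delta> = (\<lambda>e x. if x = e then 1 else 0)"
  obtain B where B: "B \<subseteq> ?Z" "vs.independent B" "?Z \<subseteq> vs.span B" "card B = vs.dim ?Z"
    by (rule vs.basis_exists)
  then have "vs.span B = ?Z" using vs.span_subspace sub by blast
  then have indep: "vs.independent (\<pi> ` B)" and card: "card (\<pi> ` B) = card B"
    using lin.independent_injective_image B(1,2) inj
    by (auto intro: card_image inj_on_subset)
  have "\<pi> f \<in> vs.span (\<delta> ` (E - T))" for f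
  proof -
    have "(\<Sum>d\<in>A. F2_scale (f d) (\<delta> d)) e = (\<Sum>d\<in>A. f d * \<delta> d e)" for A e
      by (simp only: sum_fun_apply F2_scale_def)
    moreover have "(\<Sum>d\<in>E - T. f d * \<delta> d e) = \<pi> f e" for e
    proof -
      have "(\<Sum>d\<in>E - T. f d * \<delta> d e) = (\<Sum>d\<in>E - T. if e = d then f d else 0)"
        by (intro sum.cong) (simp_all add: \<delta>_def)
      then show ?thesis using finE by (simp add: \<pi>_def)
    qed
    ultimately have "\<pi> f = (\<Sum>d\<in>E - T. F2_scale (f d) (\<delta> d))"
      by (intro ext) simp
    then show ?thesis by (simp only:) (intro vs.span_sum vs.span_scale vs.span_base imageI)
  qed
  then have "card (\<pi> ` B) \<le> card (\<delta> ` (E - T))"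
    using vs.independent_span_bound[OF _ indep] finE by blast
  also have "\<dots> \<le> card (E - T)" using finE by (intro card_image_le) simp
  also have "\<dots> = card E - card T" using T finE by (intro card_Diff_subset) (auto intro: finite_subset)
  finally have "cycle_rank V E \<le> card E - card T"
    using card B(4) by (simp add: cycle_rank_def)
  moreover have "card T \<le> card E" using T finE by (intro card_mono)
  ultimately show ?thesis using tree_card[OF T(2)] by simp
qed

section \<open>Connected graphs with at most one cycle\<close>

text \<open>Each edge outside a spanning tree closes a cycle of its own, so there is at most one
  such edge beyond the \<open>card S - 1\<close> tree edges.\<close>

lemma card_edges_le_if_one_cycle:
  assumes fin: "finite S" and v: "v \<in> S" and F: "\<And>e. e \<in> F \<Longrightarrow> e \<subseteq> S \<and> card e = 2"
    and reach: "\<And>u. u \<in> S \<Longrightarrow> (v, u) \<in> (adj F)\<^sup>*"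
    and one: "\<And>A B. A \<in> cycles F \<Longrightarrow> B \<in> cycles F \<Longrightarrow> A = B"
  shows "card F \<le> card S"
proof -
  have finF: "finite F"
    using fin F by (meson Pow_iff finite_Pow_iff finite_subset subsetI)
  obtain T where T: "T \<subseteq> F" "tree S T"
    using spanning_tree_exists[OF fin v _ reach] F by blast
  have cyc: "\<exists>A \<in> cycles F. e \<in> A \<and> A \<subseteq> insert e T" if e: "e \<in> F - T" for e
  proof -
    obtain a b where ab: "e = {a, b}" "a \<noteq> b" using F[of e] e unfolding card_2_iff by blast
    then obtain A where "A \<in> cycles (insert e T)" "e \<in> A"
      using tree_insert_edge_cycle[OF T(2), of a b] e F by auto
    moreover have "A \<subseteq> insert e T" using \<open>A \<in> cycles (insert e T)\<close> by (auto simp: cycles_def)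
    moreover have "A \<in> cycles F"
      using \<open>A \<in> cycles (insert e T)\<close> T(1) e by (auto simp: cycles_def)
    ultimately show ?thesis by blast
  qed
  \<comment> \<open>The cycle through \<open>e'\<close> equals the one through \<open>e\<close>,
    which lies in \<open>insert e T\<close>; as \<open>e'\<close> is not in \<open>T\<close>, it
    must be \<open>e\<close>.\<close>
  have "e = e'" if "e \<in> F - T" "e' \<in> F - T" for e e'
    using cyc[OF that(1)] cyc[OF that(2)] one that by blast
  then have "card (F - T) \<le> 1" using finF by (simp add: card_le_Suc0_iff_eq)
  moreover have "card F = card T + card (F - T)"
    using T(1) finF by (metis card_Diff_subset card_mono finite_subset le_add_diff_inverse)
  ultimately show ?thesis using tree_card[OF T(2)] by simp
qed

section \<open>Balls and the low-diameter decomposition\<close>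

lemma adj_relpow_mono: "E \<subseteq> E' \<Longrightarrow> (u, w) \<in> adj E ^^ n \<Longrightarrow> (u, w) \<in> adj E' ^^ n"
  by (induction n arbitrary: w) (auto simp: adj_def)

text \<open>Walks in a subgraph are walks in the whole graph. This lets a ball grown among the
  remaining vertices inherit bicycle-freeness from the original graph.\<close>

lemma ball_verts_mono:
  assumes "W \<subseteq> V" "F \<subseteq> E" "r \<le> r'"
  shows "ball_verts W F v r \<subseteq> ball_verts V E v r'"
proof
  fix u assume "u \<in> ball_verts W F v r"
  then obtain n where "u \<in> W" "real n \<le> r" "(v, u) \<in> adj F ^^ n"
    by (auto simp: ball_verts_def)
  then have "u \<in> V" "real n \<le> r'" "(v, u) \<in> adj E ^^ n"
    using assms adj_relpow_mono by (auto intro: order_trans)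
  then show "u \<in> ball_verts V E v r'" by (auto simp: ball_verts_def)
qed

lemma ball_verts_step:
  assumes "x \<in> ball_verts W F v (real j)" "{x, y} \<in> F" "y \<in> W"
  shows "y \<in> ball_verts W F v (real (Suc j))"
proof -
  obtain n where "n \<le> j" "(v, x) \<in> adj F ^^ n" using assms(1) by (auto simp: ball_verts_def)
  then have "(v, y) \<in> adj F ^^ Suc n" "Suc n \<le> Suc j" using assms(2) by (auto simp: adj_def)
  then show ?thesis using assms(3) unfolding ball_verts_def
    by (intro CollectI conjI exI[of _ "Suc n"]) (simp_all del: relpow.simps)
qed

text \<open>Every prefix of a walk of length at most \<open>r\<close> from \<open>v\<close> also
  ends within the ball, so the walk never leaves it.\<close>

lemma ball_verts_connected:
  assumes F: "F \<subseteq> Pow W" and v: "v \<in> W" and u: "u \<in> ball_verts W F v r"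
  shows "(v, u) \<in> (adj (induced_edges F (ball_verts W F v r)))\<^sup>*"
proof -
  have "(v, u) \<in> (adj (induced_edges F (ball_verts W F v r)))\<^sup>*"
    if "real n \<le> r" "(v, u) \<in> adj F ^^ n" for n
    using that
  proof (induction n arbitrary: u)
    case (Suc n)
    then obtain x where x: "(v, x) \<in> adj F ^^ n" "{x, u} \<in> F" by (auto simp: adj_def)
    have "x \<in> ball_verts W F v r"
      unfolding ball_verts_def using x F Suc.prems(1) by (intro CollectI conjI exI[of _ n]) auto
    moreover have "u \<in> ball_verts W F v r"
      unfolding ball_verts_def using x F Suc.prems
      by (intro CollectI conjI exI[of _ "Suc n"]) (auto simp del: relpow.simps)
    ultimately have "(x, u) \<in> adj (induced_edges F (ball_verts W F v r))"
      using x(2) by (auto simp: adj_def induced_edges_def)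
    moreover have "(v, x) \<in> (adj (induced_edges F (ball_verts W F v r)))\<^sup>*"
      using Suc.IH[OF _ x(1)] Suc.prems(1) by simp
    ultimately show ?case by (rule rtrancl_into_rtrancl[rotated])
  qed simp
  then show ?thesis using u by (auto simp: ball_verts_def)
qed

text \<open>The boundary edges of one ball are inner edges of the next. If all boundaries up to
  radius \<open>r\<close> were large, the inner edges would multiply by more than
  \<open>1 + \<epsilon>\<close> each time and outnumber \<open>F\<close>.\<close>

lemma exists_ball_with_small_boundary:
  fixes W :: "'a set" and v :: 'a
  assumes finF: "finite F" and F: "\<And>e. e \<in> F \<Longrightarrow> e \<subseteq> W \<and> card e = 2"
    and eps: "0 < \<epsilon>" and big: "real (card F) < (1 + \<epsilon>) ^ r"
  defines "b \<equiv> \<lambda>j. ball_verts W F v (real j)"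
  shows "\<exists>j \<le> r. real (card (F - induced_edges F (b j) - induced_edges F (W - b j)))
           \<le> \<epsilon> * real (card (induced_edges F (b j)))"
proof (rule ccontr)
  define inn where "inn = (\<lambda>j. induced_edges F (b j))"
  \<comment> \<open>Edges with exactly one end in the ball of radius \<open>j\<close>.\<close>
  define cut where "cut = (\<lambda>j. F - inn j - induced_edges F (W - b j))"
  assume "\<not> ?thesis"
  then have large: "\<epsilon> * real (card (inn j)) < real (card (cut j))" if "j \<le> r" for j
    using that by (force simp: inn_def cut_def)
  have finite: "finite (inn j)" "finite (cut j)" for j
    using finF induced_edges_subset[of F] by (auto simp: inn_def cut_def intro: finite_subset)
  have bmono: "b j \<subseteq> b (Suc j)" for j unfolding b_def by (rule ball_verts_mono) auto
  have "cut j \<subseteq> inn (Suc j)" for j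
  proof
    fix e assume e: "e \<in> cut j"
    then obtain x where x: "x \<in> e" "x \<in> b j" "e \<in> F"
      using F by (auto simp: cut_def induced_edges_def)
    then obtain y where y: "e = {x, y}" using F by (fastforce simp: card_2_iff)
    then have "y \<in> b (Suc j)" using x F ball_verts_step[of x W F v j y] by (auto simp: b_def)
    then show "e \<in> inn (Suc j)" using x y bmono by (auto simp: inn_def induced_edges_def)
  qed
  moreover have "inn j \<subseteq> inn (Suc j)" for j
    unfolding inn_def by (rule induced_edges_mono[OF bmono])
  ultimately have "card (inn j \<union> cut j) \<le> card (inn (Suc j))" for j
    using finite by (intro card_mono) auto
  moreover have "card (inn j \<union> cut j) = card (inn j) + card (cut j)" for j
    using finite by (intro card_Un_disjoint) (auto simp: cut_def)
  ultimately have "real (card (inn j)) + real (card (cut j)) \<le> real (card (inn (Suc j)))" for j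
    by (metis of_nat_add of_nat_le_iff)
  then have grow: "(1 + \<epsilon>) * real (card (inn j)) < real (card (inn (Suc j)))" if "j \<le> r" for j
    using large[OF that] by (simp add: algebra_simps) (smt (verit))
  have "(1 + \<epsilon>) ^ j \<le> real (card (inn (Suc j)))" if "j \<le> r" for j
    using that
  proof (induction j)
    \<comment> \<open>Growth at radius 0 is strict, so the ball of radius 1 has at least one inner
      edge. This starts the induction one radius late, hence the shift to
      \<open>Suc j\<close>.\<close>
    case 0
    then show ?case using grow[of 0] eps
      by (cases "card (inn (Suc 0))") (auto simp: mult_less_0_iff)
  next
    case (Suc j)
    have "(1 + \<epsilon>) ^ Suc j \<le> (1 + \<epsilon>) * real (card (inn (Suc j)))"
      using Suc eps by simp
    also have "\<dots> \<le> real (card (inn (Suc (Suc j))))" using grow[OF Suc.prems] by simp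
    finally show ?case .
  qed
  then have "(1 + \<epsilon>) ^ r \<le> real (card (inn (Suc r)))" by simp
  also have "\<dots> \<le> real (card F)"
    using finF induced_edges_subset[of F] by (auto simp: inn_def intro: card_mono)
  finally show False using big by simp
qed

text \<open>Induction on \<open>card W\<close>, cutting off one ball \<open>S\<close>. Its inner
  edges \<open>I\<close> number at most \<open>card S\<close>, the cut edges are charged to
  \<open>I\<close>, and the rest \<open>W - S\<close> is handled by induction. The error is measured
  by the edges induced on \<open>W\<close>, so that the charges to disjoint sets add up.\<close>

lemma low_diameter_decomposition_bound:
  assumes G: "simple_graph V E" and bf: "bicycle_free V E R"
    and eps: "0 < \<epsilon>" and big: "real (card E) < (1 + \<epsilon>) ^ r" and r: "real r \<le> R"
  shows "W \<subseteq> V \<Longrightarrow>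
    real (card (induced_edges E W)) \<le> real (card W) + \<epsilon> * real (card (induced_edges E W))"
proof (induction "card W" arbitrary: W rule: less_induct)
  case less
  have finE: "finite E" using G by (rule simple_graph_finite_edges)
  have finW: "finite W" using less.prems G finite_subset by (auto simp: simple_graph_def)
  have E: "e \<subseteq> V" "card e = 2" if "e \<in> E" for e using G that by (auto simp: simple_graph_def)
  show ?case
  proof (cases "W = {}")
    case True
    then have "induced_edges E W = {}" using E(2) by (force simp: induced_edges_def)
    then show ?thesis by simp
  next
    case False
    then obtain v where v: "v \<in> W" by blast
    define F where "F = induced_edges E W"
    have F: "e \<subseteq> W \<and> card e = 2" if "e \<in> F" for e
      using that E by (auto simp: F_def induced_edges_def)
    have FE: "F \<subseteq> E" unfolding F_def by (rule induced_edges_subset)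
    have finF: "finite F" using FE finE finite_subset by blast
    have "real (card F) \<le> real (card E)" using FE finE by (simp add: card_mono)
    then have bigF: "real (card F) < (1 + \<epsilon>) ^ r" using big by simp
    obtain j where j: "j \<le> r"
      "real (card (F - induced_edges F (ball_verts W F v (real j))
             - induced_edges F (W - ball_verts W F v (real j))))
         \<le> \<epsilon> * real (card (induced_edges F (ball_verts W F v (real j))))"
      using exists_ball_with_small_boundary[OF finF F eps bigF] by blast
    define S where "S = ball_verts W F v (real j)"
    define I where "I = induced_edges F S"
    define O' where "O' = induced_edges F (W - S)"
    have SW: "S \<subseteq> W" by (auto simp: S_def ball_verts_def)
    have vS: "v \<in> S" using v by (auto simp: S_def ball_verts_def intro!: exI[of _ 0])
    \<comment> \<open>Since \<open>j \<le> r \<le> R\<close>, the cut-off ball sits inside the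
      \<open>R\<close>-ball of the full graph and contains at most one cycle.\<close>
    have "I \<subseteq> induced_edges E (ball_verts V E v R)"
      using ball_verts_mono[OF less.prems FE, of "real j" R v] j(1) r FE
      by (auto simp: I_def S_def induced_edges_def)
    then have "cycles I \<subseteq> cycles (induced_edges E (ball_verts V E v R))"
      by (auto simp: cycles_def)
    then have one: "A = B" if "A \<in> cycles I" "B \<in> cycles I" for A B
      using bf v less.prems that unfolding bicycle_free_def by blast
    have FW: "F \<subseteq> Pow W" using F by auto
    have "card I \<le> card S"
    proof (rule card_edges_le_if_one_cycle[OF _ vS _ _ one])
      show "finite S" using SW finW finite_subset by blast
      show "e \<subseteq> S \<and> card e = 2" if "e \<in> I" for e
        using that F by (auto simp: I_def induced_edges_def)
      show "(v, u) \<in> (adj I)\<^sup>*" if "u \<in> S" for u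
        using ball_verts_connected[OF FW v] that unfolding I_def S_def by blast
    qed
    moreover have O: "O' = induced_edges E (W - S)"
      by (auto simp: O'_def F_def induced_edges_def)
    have "card (W - S) < card W" using vS v finW by (intro psubset_card_mono) auto
    then have "real (card O') \<le> real (card (W - S)) + \<epsilon> * real (card O')"
      unfolding O using less.prems by (intro less.hyps) auto
    moreover have "real (card (F - I - O')) \<le> \<epsilon> * real (card I)"
      using j(2) by (simp add: I_def O'_def S_def)
    moreover have "card F = card (F - I - O') + card I + card O'"
    proof -
      have "I \<subseteq> F" "O' \<subseteq> F" by (auto simp: I_def O'_def induced_edges_def)
      moreover have "I \<inter> O' = {}"
      proof -
        have "e = {}" if "e \<in> I" "e \<in> O'" for e
          using that by (auto simp: I_def O'_def induced_edges_def)
        moreover have "{} \<notin> F" using F by force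
        ultimately show ?thesis using \<open>I \<subseteq> F\<close> by blast
      qed
      moreover have "finite I" "finite O'" using \<open>I \<subseteq> F\<close> \<open>O' \<subseteq> F\<close> finF finite_subset by auto
      moreover have "card (F - (I \<union> O')) + card (I \<union> O') = card F"
        using calculation finF by (simp add: card_Diff_subset card_mono)
      moreover have "F - I - O' = F - (I \<union> O')" by blast
      ultimately show ?thesis by (simp add: card_Un_disjoint)
    qed
    moreover have "card W = card S + card (W - S)"
      using SW finW by (metis card_Diff_subset card_mono finite_subset le_add_diff_inverse)
    \<comment> \<open>\<open>I\<close> and \<open>O'\<close> are disjoint parts of \<open>F\<close>,
      so both errors fit into a single one for \<open>F\<close>.\<close>
    moreover have "\<epsilon> * real (card I) + \<epsilon> * real (card O') \<le> \<epsilon> * real (card F)"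
      using calculation(4) eps by (simp flip: distrib_left)
    ultimately show ?thesis unfolding F_def[symmetric] by linarith
  qed
qed

section \<open>Choice of \<epsilon> and the rank bound\<close>

text \<open>For \<open>0 < \<epsilon> \<le> 1\<close>, \<open>ln (1 + \<epsilon>)\<close> is at
  least \<open>\<epsilon> / 2 = 2 * ln s / R\<close>. Multiplied by an exponent of at least
  \<open>7 / 8 * R\<close>, this gives \<open>7 / 4 * ln s\<close>, which exceeds
  \<open>ln s\<close>.\<close>

lemma less_power_floor:
  fixes s R :: real
  assumes R: "8 \<le> R" and s: "8 \<le> s" and eps: "4 * ln s / R \<le> 1"
  shows "s < (1 + 4 * ln s / R) ^ nat \<lfloor>R\<rfloor>"
proof -
  define \<epsilon> where "\<epsilon> = 4 * ln s / R"
  have "0 < ln s" using s by simp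
  then have pos: "0 < \<epsilon>" using R by (simp add: \<epsilon>_def)
  have "ln (inverse (1 + \<epsilon>)) \<le> inverse (1 + \<epsilon>) - 1" using pos by (intro ln_le_minus_one) simp
  moreover have "\<epsilon> / (1 + \<epsilon>) = 1 - inverse (1 + \<epsilon>)" using pos by (simp add: field_simps)
  ultimately have "ln (1 + \<epsilon>) \<ge> \<epsilon> / (1 + \<epsilon>)" using pos by (simp add: ln_inverse)
  moreover have "\<epsilon> / (1 + \<epsilon>) \<ge> \<epsilon> / 2" using pos eps by (intro divide_left_mono) (auto simp: \<epsilon>_def)
  ultimately have ln: "\<epsilon> / 2 \<le> ln (1 + \<epsilon>)" by linarith
  \<comment> \<open>Rounding down loses less than 1, which is at most \<open>R / 8\<close> because
    \<open>8 \<le> R\<close>.\<close>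
  have floor: "7 / 8 * R \<le> real (nat \<lfloor>R\<rfloor>)" using R by linarith
  have "ln s < 7 / 8 * R * (\<epsilon> / 2)" using R \<open>0 < ln s\<close> by (simp add: \<epsilon>_def)
  also have "\<dots> \<le> real (nat \<lfloor>R\<rfloor>) * ln (1 + \<epsilon>)" using floor ln pos R by (intro mult_mono) auto
  also have "\<dots> = ln ((1 + \<epsilon>) ^ nat \<lfloor>R\<rfloor>)" using pos by (simp add: ln_realpow)
  finally show ?thesis unfolding \<epsilon>_def[symmetric] using s pos by simp
qed

lemma card_edges_le_card_verts_plus:
  assumes G: "simple_graph V E" and R: "8 \<le> R" "R \<le> real (card E)" and bf: "bicycle_free V E R"
  shows "real (card E) \<le> real (card V) + 4 * ln (real (card E)) / R * real (card E)"
proof (cases "4 * ln (real (card E)) / R \<le> 1")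
  case True
  let ?\<epsilon> = "4 * ln (real (card E)) / R"
  have pos: "0 < ?\<epsilon>" using R by simp
  have "induced_edges E V = E" using G by (auto simp: induced_edges_def simple_graph_def)
  moreover have "real (card E) < (1 + ?\<epsilon>) ^ nat \<lfloor>R\<rfloor>" using R True by (intro less_power_floor) auto
  moreover have "real (nat \<lfloor>R\<rfloor>) \<le> R" using R by simp
  ultimately show ?thesis
    using low_diameter_decomposition_bound[OF G bf pos, of "nat \<lfloor>R\<rfloor>" V] by simp
next
  case False
  \<comment> \<open>When \<epsilon> exceeds 1 the error term alone already covers all edges.\<close>
  then have "1 * real (card E) \<le> 4 * ln (real (card E)) / R * real (card E)"
    by (intro mult_right_mono) auto
  then show ?thesis by simp
qed

theorem lemma20:
  "\<exists>C::real. \<forall>(V::nat set) (E::nat set set) (R::real).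
     simple_graph V E \<longrightarrow> connected_graph V E \<longrightarrow>
     8 \<le> R \<longrightarrow> R \<le> real (card E) \<longrightarrow>
     (\<forall>v\<in>V. 2 \<le> degree E v) \<longrightarrow>
     bicycle_free V E R \<longrightarrow>
     real (cycle_rank V E) \<le> 1 + C * real (card E) * ln (real (card E)) / R"
\<comment> \<open>The constant 4 is the one in \<open>\<epsilon> = 4 * ln s / R\<close>: the rank is
  at most \<open>card E - card V + 1\<close>, and the excess of edges over vertices is at most
  \<open>\<epsilon> * s\<close>, with \<open>s = card E\<close>.\<close>
proof (intro exI[of _ 4] allI impI)
  fix V :: "nat set" and E :: "nat set set" and R :: real
  assume G: "simple_graph V E" and conn: "connected_graph V E"
    and R: "8 \<le> R" "R \<le> real (card E)" and bf: "bicycle_free V E R"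
  have "real (cycle_rank V E) + real (card V) \<le> real (card E) + 1"
    using cycle_rank_le[OF G conn] by linarith
  moreover have "4 * ln (real (card E)) / R * real (card E)
      = 4 * real (card E) * ln (real (card E)) / R"
    by simp
  ultimately show "real (cycle_rank V E) \<le> 1 + 4 * real (card E) * ln (real (card E)) / R"
    using card_edges_le_card_verts_plus[OF G R bf] by linarith
qed

end
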